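(* Given $r\ge 0$ and $a$ a congruence class modulo $3$, there exist a natural number $K_{r,a}>1$ and $h_{r,a}\in\mathbb{Q}$ such that for all $k\ge K_{r,a}$ with $k\equiv a\pmod{3}$ we have $E_r(k)=h_{r,a}E(k)$, and these $h_{r,a}$ and $K_{r,a}$ are given by the following tables (entries are listed as $r:\ (h_{r,a},K_{r,a})$). Case $a\equiv 0\pmod 3$: $0:(1,3)$; $1:(8/9,6)$; $2:(64/81,12)$; $3:(7/9,12)$; $4:(20/27,12)$; $5:(19/27,12)$; $6:(512/729,18)$; $7:(56/81,18)$; $8:(55/81,18)$; $9:(164/243,18)$; $10:(163/243,18)$; and for every integer $n\ge 6$, $\ 2n-1:\ (2/3+2/3^n,\ 3n)$ and $2n:\ (2/3+1/3^n,\ 3n)$. Case $a\equiv 2\pmod 3$: $0:(1,2)$; $1:(8/9,8)$; $2:(5/6,8)$; $3:(64/81,14)$; $4:(7/9,14)$; $5:(20/27,14)$; $6:(13/18,14)$; $7:(19/27,14)$; $8:(512/729,20)$; $9:(56/81,20)$; $10:(37/54,20)$; $11:(55/81,20)$; $12:(164/243,20)$; $13:(109/162,20)$; $14:(163/243,20)$; and for every integer $n\ge 6$, $\ 3n-3:\ (2/3+2/3^n,\ 3n+2)$, $\ 3n-2:\ (2/3+1/(2\cdot 3^{n-1}),\ 3n+2)$ and $3n-1:\ (2/3+1/3^n,\ 3n+2)$. Case $a\equiv 1\pmod 3$: $0:(1,4)$; $1:(8/9,10)$; $2:(5/6,10)$; $3:(64/81,16)$; $4:(7/9,16)$; $5:(41/54,16)$;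 and for every integer $n\ge 4$, $\ n+2:\ (3/4+1/(4\cdot 3^n),\ 3n+4)$. Moreover, for such $r$ and $k$ (that is, $k\equiv a \pmod 3$ and $k\ge K_{r,a}$), we have $E_r(k)>E(k-1)$ and therefore $\|E_r(k)\|=k$ (and thus for such $r$ and $k$, $E_r(k)$ is not just the $r$'th largest number with complexity at most $k$, but the $r$'th largest number with complexity exactly $k$, counting from $r=0$).
   Context: Natural numbers are positive integers. The complexity $\|n\|$ of a natural number $n$ is the least number of $1$'s needed to write $n$ using any combination of addition and multiplication (with arbitrary parenthesization). For $k\ge 1$, $E(k)$ is the largest natural number $n$ with $\|n\|\le k$. For $r\ge 0$ and $k\ge 1$, $E_r(k)$ is the $r$'th largest natural number of complexity at most $k$, with $0$-based indexing, so that $E_0(k)=E(k)$, $E_1(k)$ is the next largest number of complexity at most $k$, and so on. *)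

theory Defs
  imports Complex_Main "HOL-Number_Theory.Cong"
begin

datatype expr = One | Add expr expr | Mul expr expr

primrec expr_val :: "expr \<Rightarrow> nat" where
  "expr_val One = 1"
| "expr_val (Add s t) = expr_val s + expr_val t"
| "expr_val (Mul s t) = expr_val s * expr_val t"

primrec num_ones :: "expr \<Rightarrow> nat" where
  "num_ones One = 1"
| "num_ones (Add s t) = num_ones s + num_ones t"
| "num_ones (Mul s t) = num_ones s + num_ones t"

text \<open>Meaningful for positive arguments only: no expression has value 0, so the value of
  \<open>cpx 0\<close> is unspecified, and \<open>0\<close> is excluded explicitly from the sets below.\<close>

definition cpx :: "nat \<Rightarrow> nat" where
  "cpx n = (LEAST k. \<exists>t. expr_val t = n \<and> num_ones t = k)"

definition cpx_le :: "nat \<Rightarrow> nat set" where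
  "cpx_le k = {n. 0 < n \<and> cpx n \<le> k}"

definition cpx_eq :: "nat \<Rightarrow> nat set" where
  "cpx_eq k = {n. 0 < n \<and> cpx n = k}"

definition E :: "nat \<Rightarrow> nat" where
  "E k = Max (cpx_le k)"

text \<open>\<open>n\<close> is the \<open>r\<close>'th largest element of \<open>A\<close>, counting from \<open>r = 0\<close>. Finiteness is required
  because \<open>card\<close> of an infinite set is \<open>0\<close>.\<close>

definition rth_largest :: "nat set \<Rightarrow> nat \<Rightarrow> nat \<Rightarrow> bool" where
  "rth_largest A r n \<longleftrightarrow> n \<in> A \<and> finite {m \<in> A. n < m} \<and> card {m \<in> A. n < m} = r"

text \<open>Unspecified if fewer than \<open>r + 1\<close> numbers have complexity at most \<open>k\<close>.\<close>

definition Er :: "nat \<Rightarrow> nat \<Rightarrow> nat" where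
  "Er r k = (THE n. rth_largest (cpx_le k) r n)"

text \<open>Each of the following predicates says that \<open>T r\<close> is the pair of \<open>h\<^sub>r\<^sub>,\<^sub>a\<close> and \<open>K\<^sub>r\<^sub>,\<^sub>a\<close> listed in the
  table for the congruence class of \<open>a\<close> modulo \<open>3\<close>. In each table every \<open>r\<close> occurs exactly once,
  so the table determines \<open>T\<close>.\<close>

definition table0 :: "(nat \<Rightarrow> rat \<times> nat) \<Rightarrow> bool" where
  "table0 T \<longleftrightarrow>
     T 0 = (1, 3) \<and>
     T 1 = (8/9, 6) \<and>
     T 2 = (64/81, 12) \<and>
     T 3 = (7/9, 12) \<and>
     T 4 = (20/27, 12) \<and>
     T 5 = (19/27, 12) \<and>
     T 6 = (512/729, 18) \<and>
     T 7 = (56/81, 18) \<and>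
     T 8 = (55/81, 18) \<and>
     T 9 = (164/243, 18) \<and>
     T 10 = (163/243, 18) \<and>
     (\<forall>n\<ge>6. T (2 * n - 1) = (2/3 + 2/3^n, 3 * n) \<and>
           T (2 * n) = (2/3 + 1/3^n, 3 * n))"

definition table2 :: "(nat \<Rightarrow> rat \<times> nat) \<Rightarrow> bool" where
  "table2 T \<longleftrightarrow>
     T 0 = (1, 2) \<and>
     T 1 = (8/9, 8) \<and>
     T 2 = (5/6, 8) \<and>
     T 3 = (64/81, 14) \<and>
     T 4 = (7/9, 14) \<and>
     T 5 = (20/27, 14) \<and>
     T 6 = (13/18, 14) \<and>
     T 7 = (19/27, 14) \<and>
     T 8 = (512/729, 20) \<and>
     T 9 = (56/81, 20) \<and>
     T 10 = (37/54, 20) \<and>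
     T 11 = (55/81, 20) \<and>
     T 12 = (164/243, 20) \<and>
     T 13 = (109/162, 20) \<and>
     T 14 = (163/243, 20) \<and>
     (\<forall>n\<ge>6. T (3 * n - 3) = (2/3 + 2/3^n, 3 * n + 2) \<and>
           T (3 * n - 2) = (2/3 + 1/(2 * 3^(n - 1)), 3 * n + 2) \<and>
           T (3 * n - 1) = (2/3 + 1/3^n, 3 * n + 2))"

definition table1 :: "(nat \<Rightarrow> rat \<times> nat) \<Rightarrow> bool" where
  "table1 T \<longleftrightarrow>
     T 0 = (1, 4) \<and>
     T 1 = (8/9, 10) \<and>
     T 2 = (5/6, 10) \<and>
     T 3 = (64/81, 16) \<and>
     T 4 = (7/9, 16) \<and>
     T 5 = (41/54, 16) \<and>
     (\<forall>n\<ge>4. T (n + 2) = (3/4 + 1/(4 * 3^n), 3 * n + 4))"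

end

theory Submission
  imports Defs
begin

text \<open>Call a value \<open>n\<close> of an expression with \<open>k\<close> ones leading if \<open>n > E (k - 1)\<close>. If a sum is
  leading then it equals \<open>E (k - 1) + 1\<close>, because \<open>E i + E j \<le> E (i + j - 1) + 1\<close>; if a product is
  leading then so are both factors, because \<open>E\<close> is supermultiplicative. Hence the ratios
  \<open>n / E k\<close> of leading values lie in the smallest sets (one for each class of \<open>k\<close> modulo 3) that
  contain the ratios of the sums and are closed under products staying above
  \<open>E (k - 1) / E k \<in> {2/3, 3/4}\<close>. All but finitely many ratios are so close to this bound that
  only the factor 1 keeps them above it, which makes the closure explicit. The tables
  enumerate it in decreasing order, and \<open>K\<close> ensures that all ratios up to index \<open>r\<close> are attained.\<close>

section \<open>The largest value with a given number of ones\<close>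

text \<open>The value at 0 is chosen such that \<open>emax (3 * m) = 3 ^ m\<close> for all \<open>m\<close>.\<close>

fun emax :: "nat \<Rightarrow> nat" where
  "emax 0 = 1"
| "emax (Suc 0) = 1"
| "emax (Suc (Suc 0)) = 2"
| "emax (Suc (Suc (Suc 0))) = 3"
| "emax (Suc (Suc (Suc (Suc 0)))) = 4"
| "emax (Suc (Suc (Suc (Suc (Suc n))))) = 3 * emax (Suc (Suc n))"

lemma emax_pos: "0 < emax k"
  by (induction k rule: emax.induct) auto

lemma emax_add_3: "2 \<le> k \<Longrightarrow> emax (k + 3) = 3 * emax k"
  by (cases k rule: emax.cases) (auto simp: numeral_eq_Suc)

text \<open>Follows the recursion \<open>emax (k + 3) = 3 * emax k\<close>. It starts at 2 because
  the recursion fails at 1: \<open>emax 4\<close> is 4, not 3.\<close>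

lemma induct_step_3 [consumes 1, case_names 2 3 4 step]:
  fixes k :: nat
  assumes "2 \<le> k" "P 2" "P 3" "P 4" "\<And>k. 2 \<le> k \<Longrightarrow> P k \<Longrightarrow> P (k + 3)"
  shows "P k"
  using assms(1)
proof (induction k rule: less_induct)
  case (less k)
  then consider "k = 2" | "k = 3" | "k = 4" | "5 \<le> k" by linarith
  then show ?case
  proof cases
    case 4
    then have "P (k - 3 + 3)" by (intro assms(5) less) auto
    with 4 show ?thesis by simp
  qed (use assms in auto)
qed

lemma emax_small: "emax 1 = 1" "emax 2 = 2" "emax 3 = 3" "emax 4 = 4" "emax 5 = 6" "emax 6 = 9"
  "emax 7 = 12" "emax 8 = 18"
  by (simp_all add: numeral_eq_Suc)

lemma emax_mult3: "emax (3 * m) = 3 ^ m"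
proof (induction m)
  case (Suc m)
  then show ?case using emax_add_3[of "3 * m"] by (cases "m = 0") (auto simp: emax_small add.commute)
qed simp

lemma emax_mult3_plus2: "emax (3 * m + 2) = 2 * 3 ^ m"
proof (induction m)
  case (Suc m)
  then show ?case using emax_add_3[of "3 * m + 2"] by (simp add: add.commute)
qed (simp add: emax_small)

lemma emax_mult3_plus4: "emax (3 * m + 4) = 4 * 3 ^ m"
proof (induction m)
  case (Suc m)
  then show ?case using emax_add_3[of "3 * m + 4"] by (simp add: add.commute)
qed (simp add: emax_small)

lemma emax_strict_mono_Suc: "1 \<le> k \<Longrightarrow> emax k < emax (k + 1)"
proof (cases "k = 1")
  case False
  assume "1 \<le> k"
  with False have "2 \<le> k" by simp
  then show ?thesis
  proof (induction k rule: induct_step_3)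
    case (step k)
    then show ?case using emax_add_3[of k] emax_add_3[of "k + 1"] by (simp add: algebra_simps)
  qed (simp_all add: emax_small)
qed (simp add: emax_small)

lemma emax_mono: "i \<le> j \<Longrightarrow> emax i \<le> emax j"
proof (induction j rule: dec_induct)
  case (step j)
  then show ?case using emax_strict_mono_Suc[of j] by (cases "j = 0") (auto simp: emax_small)
qed simp

text \<open>\<open>emax 1\<close> is the only value that does not fit the geometric pattern.\<close>

lemma emax_mult:
  assumes "2 \<le> i" "2 \<le> j"
  shows "9 * (emax i * emax j) =
    (if i mod 3 = 1 \<and> j mod 3 \<noteq> 0 \<or> j mod 3 = 1 \<and> i mod 3 \<noteq> 0 then 8 else 9) * emax (i + j)"
proof -
  \<comment> \<open>Both sides triple when \<open>i\<close> or \<open>j\<close> grows by 3, so the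
    factor can be read off from \<open>i, j \<in> {2, 3, 4}\<close>: the defect 8/9 comes from
    \<open>4 * 2\<close> against 9 and from \<open>4 * 4\<close> against 18.\<close>
  have base: "9 * (emax i * emax j) =
    (if i mod 3 = 1 \<and> j mod 3 \<noteq> 0 \<or> j mod 3 = 1 \<and> i mod 3 \<noteq> 0 then 8 else 9) * emax (i + j)"
    if "2 \<le> j" "i = 2 \<or> i = 3 \<or> i = 4" for i j
    using that
  proof (induction j rule: induct_step_3)
    case (step j)
    then show ?case
      using emax_add_3[of j] emax_add_3[of "i + j"] by (simp add: add.assoc[symmetric] split: if_splits)
  qed (auto simp: emax_small)
  show ?thesis
    using assms(1)
  proof (induction i rule: induct_step_3)
    case (step i)
    have "emax (i + 3 + j) = 3 * emax (i + j)"
      using emax_add_3[of "i + j"] step assms by (simp add: algebra_simps)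
    with step show ?case
      using emax_add_3[of i] by (simp split: if_splits)
  qed (use base[OF assms(2)] in auto)
qed

lemma emax_mult_le:
  assumes "1 \<le> i" "1 \<le> j"
  shows "emax i * emax j \<le> emax (i + j)"
proof -
  consider "i = 1" | "j = 1" | "2 \<le> i" "2 \<le> j" using assms by linarith
  then show ?thesis
  proof cases
    case 3
    then show ?thesis using emax_mult[of i j] by (simp split: if_splits)
  qed (use emax_mono[of j "Suc j"] emax_mono[of i "i + 1"] in auto)
qed

text \<open>Raising \<open>i\<close> by 3 triples \<open>emax i\<close> and the maximum on the
  right. Tripling the whole inequality would turn the constant 1 into 3, but the summand
  \<open>emax j\<close> stays as it is, and the saved \<open>2 * emax j \<ge> 2\<close> pays for the
  difference. Equality holds at \<open>i = 1\<close>.\<close>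

lemma emax_add_le:
  assumes "1 \<le> i" "1 \<le> j"
  shows "emax i + emax j \<le> emax (i + j - 1) + 1"
proof -
  have one: "emax i + emax j \<le> emax (i + j - 1) + 1" if "i = 1" for i j
    using that by simp
  have base: "emax i + emax j \<le> emax (i + j - 1) + 1"
    if "2 \<le> j" "i = 2 \<or> i = 3 \<or> i = 4" for i j
    using that
  proof (induction j rule: induct_step_3)
    case (step j)
    have "2 \<le> i + j - 1" "i + (j + 3) - 1 = i + j - 1 + 3" using step by auto
    then have "emax (i + (j + 3) - 1) = 3 * emax (i + j - 1)"
      using emax_add_3[of "i + j - 1"] by simp
    with step show ?case
      using emax_add_3[of j] emax_pos[of i] by simp
  qed (auto simp: emax_small)
  show ?thesis
  proof (cases "i = 1 \<or> j = 1")
    case True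
    then show ?thesis using one[of i j] one[of j i] by (auto simp: add.commute)
  next
    case False
    with assms have "2 \<le> i" "2 \<le> j" by auto
    from this(1) show ?thesis
    proof (induction i rule: induct_step_3)
      case (step i)
      have "2 \<le> i + j - 1" "i + 3 + j - 1 = i + j - 1 + 3" using step \<open>2 \<le> j\<close> by auto
      then have "emax (i + 3 + j - 1) = 3 * emax (i + j - 1)"
        using emax_add_3[of "i + j - 1"] by simp
      with step show ?case
        using emax_add_3[of i] emax_pos[of j] by simp
    qed (use base[where j = j] \<open>2 \<le> j\<close> in metis)+
  qed
qed

text \<open>The quotient \<open>emax (k - 1) / emax k\<close> from \<open>k = 3\<close> on. At
  \<open>k = 2\<close> the quotient is 1/2, so only an inequality holds there.\<close>

definition threshold :: "nat \<Rightarrow> rat" where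
  "threshold k = (if k mod 3 = 1 then 3/4 else 2/3)"

lemma emax_pred:
  assumes "3 \<le> k"
  shows "of_nat (emax (k - 1)) = threshold k * of_nat (emax k)"
proof -
  have "2 \<le> k - 1" using assms by simp
  then have "of_nat (emax (k - 1)) = threshold (k - 1 + 1) * of_nat (emax (k - 1 + 1))"
  proof (induction "k - 1" arbitrary: k rule: induct_step_3)
    case (step l)
    have "of_nat (emax l) = threshold (l + 1) * of_nat (emax (l + 1))"
      using step(2)[of "l + 1"] by simp
    moreover have "k - 1 = l + 3" using step by simp
    moreover have "(l + 4) mod 3 = Suc l mod 3" by presburger
    ultimately show ?case
      using emax_add_3[of l] emax_add_3[of "l + 1"] step(1)
      by (simp add: threshold_def algebra_simps split: if_splits)
  qed (auto simp: emax_small threshold_def)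
  then show ?thesis using assms by simp
qed

lemma emax_pred_le:
  assumes "2 \<le> k"
  shows "of_nat (emax (k - 1)) \<le> threshold k * of_nat (emax k)"
proof (cases "k = 2")
  case True
  then show ?thesis by (simp add: emax_small threshold_def)
next
  case False
  then show ?thesis using emax_pred[of k] assms by simp
qed

section \<open>Complexity in terms of expressions\<close>

text \<open>Exactly \<open>k\<close> ones, with no minimality, so that the counts simply add up
  under sums and products.\<close>

definition rep :: "nat \<Rightarrow> nat \<Rightarrow> bool" where
  "rep n k \<longleftrightarrow> (\<exists>t. expr_val t = n \<and> num_ones t = k)"

lemma rep_add: "rep m i \<Longrightarrow> rep n j \<Longrightarrow> rep (m + n) (i + j)"
  unfolding rep_def by (metis expr_val.simps(2) num_ones.simps(2))

lemma rep_mult: "rep m i \<Longrightarrow> rep n j \<Longrightarrow> rep (m * n) (i + j)"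
  unfolding rep_def by (metis expr_val.simps(3) num_ones.simps(3))

lemma rep_1: "rep 1 1"
  unfolding rep_def by (metis expr_val.simps(1) num_ones.simps(1))

lemma rep_2: "rep 2 2"
  using rep_add[OF rep_1 rep_1] by (simp add: numeral_eq_Suc)

lemma rep_3: "rep 3 3"
  using rep_add[OF rep_1 rep_2] by (simp add: numeral_eq_Suc)

lemma rep_mult_power3: "rep n k \<Longrightarrow> rep (n * 3 ^ j) (k + 3 * j)"
proof (induction j)
  case (Suc j)
  then show ?case using rep_mult[OF rep_3 Suc.IH] by (simp add: algebra_simps)
qed simp

lemma rep_mult_power2: "rep n k \<Longrightarrow> rep (n * 2 ^ j) (k + 2 * j)"
proof (induction j)
  case (Suc j)
  then show ?case using rep_mult[OF rep_2 Suc.IH] by (simp add: algebra_simps)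
qed simp

lemma rep_power3: "1 \<le> j \<Longrightarrow> rep (3 ^ j) (3 * j)"
  using rep_mult_power3[OF rep_3, of "j - 1"] by (cases j) auto

lemma rep_power2: "1 \<le> j \<Longrightarrow> rep (2 ^ j) (2 * j)"
  using rep_mult_power2[OF rep_2, of "j - 1"] by (cases j) auto

section \<open>The maximum \<open>E\<close> equals \<open>emax\<close>\<close>

lemma num_ones_pos: "1 \<le> num_ones t"
  by (induction t) auto

lemma expr_val_pos: "1 \<le> expr_val t"
  by (induction t) auto

text \<open>The upper half of Selfridge's formula for \<open>E\<close>. A sum stays within the bound
  since \<open>emax (i + j - 1) + 1 \<le> emax (i + j)\<close> by strict growth, a product by
  supermultiplicativity.\<close>

lemma expr_val_le_emax: "expr_val t \<le> emax (num_ones t)"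
proof (induction t)
  case (Add s t)
  let ?i = "num_ones s" and ?j = "num_ones t"
  have "emax ?i + emax ?j \<le> emax (?i + ?j - 1) + 1"
    by (intro emax_add_le num_ones_pos)
  also have "\<dots> \<le> emax (?i + ?j)"
  proof -
    have "1 \<le> ?i + ?j - 1" "?i + ?j - 1 + 1 = ?i + ?j"
      using num_ones_pos[of s] num_ones_pos[of t] by auto
    then show ?thesis using emax_strict_mono_Suc[of "?i + ?j - 1"] by simp
  qed
  finally show ?case using Add by simp
next
  case (Mul s t)
  then have "expr_val s * expr_val t \<le> emax (num_ones s) * emax (num_ones t)"
    by (intro mult_mono) auto
  also have "\<dots> \<le> emax (num_ones s + num_ones t)"
    by (intro emax_mult_le num_ones_pos)
  finally show ?case by simp
qed simp

lemma rep_exists: "1 \<le> n \<Longrightarrow> \<exists>k. rep n k"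
proof (induction n rule: dec_induct)
  case base
  show ?case using rep_1 by auto
next
  case (step n)
  then show ?case using rep_add[OF _ rep_1] by (metis Suc_eq_plus1)
qed

lemma cpx_eq_Least: "cpx n = (LEAST k. rep n k)"
  by (simp add: cpx_def rep_def)

lemma rep_cpx: "0 < n \<Longrightarrow> rep n (cpx n)"
  unfolding cpx_eq_Least using rep_exists[of n] by (auto intro: LeastI)

lemma cpx_le_of_rep: "rep n k \<Longrightarrow> cpx n \<le> k"
  unfolding cpx_eq_Least by (rule Least_le)

lemma rep_le_emax: "rep n k \<Longrightarrow> n \<le> emax k"
  unfolding rep_def using expr_val_le_emax by auto

lemma rep_pos: "rep n k \<Longrightarrow> 0 < n"
  unfolding rep_def using expr_val_pos by (metis not_gr_zero not_one_le_zero)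

text \<open>From 2 on, the bound is attained by threes together with at most one factor 2 or 4,
  where \<open>4 = 2 * 2\<close> costs four ones.\<close>

lemma rep_emax:
  assumes "1 \<le> k"
  shows "rep (emax k) k"
proof (cases "k = 1")
  case False
  with assms have "2 \<le> k" by simp
  then show ?thesis
  proof (induction k rule: induct_step_3)
    case 4
    then show ?case using rep_power2[of 2] by (simp add: emax_small)
  next
    case (step k)
    then show ?case using rep_mult_power3[of _ k 1] emax_add_3[of k] by (simp add: mult.commute)
  qed (auto simp: emax_small rep_2 rep_3)
qed (use rep_1 in \<open>simp add: emax_small\<close>)

lemma cpx_le_bounded: "n \<in> cpx_le k \<Longrightarrow> n \<le> emax k"
  unfolding cpx_le_def using rep_le_emax[OF rep_cpx] emax_mono by (blast intro: order_trans)

lemma finite_cpx_le: "finite (cpx_le k)"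
  by (rule finite_subset[of _ "{..emax k}"]) (auto dest: cpx_le_bounded)

lemma E_eq_emax:
  assumes "1 \<le> k"
  shows "E k = emax k"
  unfolding E_def
proof (rule Max_eqI[OF finite_cpx_le])
  show "emax k \<in> cpx_le k"
    using rep_emax[OF assms] emax_pos by (auto simp: cpx_le_def cpx_le_of_rep)
qed (rule cpx_le_bounded)

text \<open>Source of the claim on exact complexity: a smaller complexity would force
  \<open>n \<le> emax (k - 1)\<close>.\<close>

lemma cpx_eq_if_leading:
  assumes "2 \<le> k" "emax (k - 1) < n" "n \<in> cpx_le k"
  shows "cpx n = k"
proof (rule ccontr)
  assume "cpx n \<noteq> k"
  with assms have "n \<in> cpx_le (k - 1)" by (auto simp: cpx_le_def)
  then show False using cpx_le_bounded assms(2) by fastforce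
qed

section \<open>Ratios of leading values\<close>

text \<open>Class 0, denominators \<open>3 ^ m\<close>: \<open>2/3 + 1/3^n\<close> stems from the
  sums \<open>2 * 3 ^ (n - 1) + 1\<close>, \<open>2/3 + 2/3^n\<close> from the products
  \<open>2 * (3 ^ (n - 1) + 1)\<close>, and the two extra ratios from \<open>2 ^ 6\<close> and
  \<open>2 ^ 9\<close>.\<close>

definition ratios0 :: "rat set" where
  "ratios0 = {2/3 + 2/3^n |n. 2 \<le> n} \<union> {2/3 + 1/3^n |n. 1 \<le> n} \<union> {64/81, 512/729}"

text \<open>Class 1, denominators \<open>4 * 3 ^ n\<close>: the sums \<open>3 ^ (n + 1) + 1\<close>,
  and the powers \<open>2 ^ 5\<close> and \<open>2 ^ 8\<close> over 36 and 324.\<close>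

definition ratios1 :: "rat set" where
  "ratios1 = range (\<lambda>n. 3/4 + 1/(4 * 3^n)) \<union> {8/9, 64/81}"

text \<open>Class 2: doubling carries over the ratios of class 0; the sums
  \<open>4 * 3 ^ (n - 1) + 1\<close> over \<open>2 * 3 ^ n\<close> are new.\<close>

definition ratios2 :: "rat set" where
  "ratios2 = ratios0 \<union> {2/3 + 1/(2 * 3^n) |n. 1 \<le> n}"

definition ratios :: "nat \<Rightarrow> rat set" where
  "ratios k = (if k mod 3 = 0 then ratios0 else if k mod 3 = 1 then ratios1 else ratios2)"

lemma ratios0I:
  "2 \<le> n \<Longrightarrow> 2/3 + 2/3^n \<in> ratios0" "1 \<le> n \<Longrightarrow> 2/3 + 1/3^n \<in> ratios0"
  "64/81 \<in> ratios0" "512/729 \<in> ratios0"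
  by (auto simp: ratios0_def)

lemma ratios1I: "3/4 + 1/(4 * 3^n) \<in> ratios1" "8/9 \<in> ratios1" "64/81 \<in> ratios1"
  by (auto simp: ratios1_def)

lemma ratios2I: "x \<in> ratios0 \<Longrightarrow> x \<in> ratios2" "1 \<le> n \<Longrightarrow> 2/3 + 1/(2 * 3^n) \<in> ratios2"
  by (auto simp: ratios2_def)

lemma ratios0_elems: "1 \<in> ratios0" "8/9 \<in> ratios0" "20/27 \<in> ratios0" "56/81 \<in> ratios0"
  using ratios0I(2)[of 1] ratios0I(1)[of 2] ratios0I(1)[of 3] ratios0I(1)[of 4] by simp_all

lemma ratios1_elems: "{1, 8/9, 5/6, 64/81, 7/9} \<subseteq> ratios1"
  using ratios1I(1)[of 0] ratios1I(1)[of 1] ratios1I(1)[of 2] ratios1I(2,3) by simp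

section \<open>Large elements of the ratio sets\<close>

lemma power3_ge: "i \<le> n \<Longrightarrow> (3::rat) ^ i \<le> 3 ^ n"
  by (rule power_increasing) auto

text \<open>The cut at 3/4 serves twice: it is the threshold of class 1, and since
  \<open>8/9 * 3/4 = 2/3\<close>, a factor up to 3/4 times a factor up to 8/9 never exceeds
  2/3.\<close>

lemma ratios0_large:
  assumes "x \<in> ratios0" "3/4 < x"
  shows "x \<in> {1, 8/9, 64/81, 7/9}"
proof -
  consider n where "x = 2/3 + 2/3^n" "2 \<le> n" | n where "x = 2/3 + 1/3^n" "1 \<le> n"
    | "x = 64/81 \<or> x = 512/729"
    using assms(1) by (auto simp: ratios0_def)
  then show ?thesis
  proof cases
    case 1
    \<comment> \<open>The assumption amounts to \<open>3^n < 24\<close>; relaxing 24 to a power of 3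
      lets the exponents be compared.\<close>
    have "(3::rat)^n < 3^3" using assms(2) unfolding 1(1) by (simp add: field_simps)
    then have "n < 3" by (rule power_less_imp_less_exp[rotated]) simp
    with 1 have "n = 2" by simp
    with 1 show ?thesis by simp
  next
    case 2
    have "(3::rat)^n < 3^3" using assms(2) unfolding 2(1) by (simp add: field_simps)
    then have "n < 3" by (rule power_less_imp_less_exp[rotated]) simp
    with 2 have "n = 1 \<or> n = 2" by auto
    with 2 show ?thesis by auto
  qed (use assms(2) in auto)
qed

lemma ratios2_large:
  assumes "x \<in> ratios2" "3/4 < x"
  shows "x \<in> {1, 8/9, 5/6, 64/81, 7/9}"
proof (cases "x \<in> ratios0")
  case True
  then show ?thesis using ratios0_large assms(2) by blast
next
  case False
  then obtain n where n: "x = 2/3 + 1/(2 * 3^n)" "1 \<le> n"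
    using assms(1) by (auto simp: ratios2_def)
  have "(3::rat)^n < 3^2" using assms(2) unfolding n(1) by (simp add: field_simps)
  then have "n < 2" by (rule power_less_imp_less_exp[rotated]) simp
  with n have "n = 1" by simp
  with n show ?thesis by simp
qed

lemma ratios2_large_in_ratios1: "x \<in> ratios2 \<Longrightarrow> 3/4 < x \<Longrightarrow> x \<in> ratios1"
  using ratios2_large ratios1_elems by blast

text \<open>The gap between 5/6 and 8/9 is decisive below, because
  \<open>8/9 * 5/6 < 3/4\<close>.\<close>

lemma ratios1_large:
  assumes "x \<in> ratios1"
  shows "x = 1 \<or> x = 8/9 \<or> x \<le> 5/6"
proof -
  have "3/4 + 1/(4 * 3^n) = (1::rat) \<or> 3/4 + 1/(4 * 3^n) \<le> (5/6::rat)" for n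
    using power3_ge[of 1 n] by (cases "n = 0") (auto simp: field_simps)
  with assms show ?thesis unfolding ratios1_def by fastforce
qed

lemma ratios_threshold: "x \<in> ratios k \<Longrightarrow> threshold k < x"
  by (auto simp: ratios_def ratios0_def ratios1_def ratios2_def threshold_def split: if_splits)

lemma ratios_pos: "x \<in> ratios k \<Longrightarrow> 0 < x"
  using ratios_threshold[of x k] by (simp add: threshold_def split: if_splits)

lemma ratios2_pos: "x \<in> ratios2 \<Longrightarrow> 0 < x"
  using ratios_pos[of x 2] by (simp add: ratios_def)

lemma ratios1_pos: "x \<in> ratios1 \<Longrightarrow> 0 < x"
  using ratios_pos[of x 1] by (simp add: ratios_def)

lemma ratios2_le: "x \<in> ratios2 \<Longrightarrow> x = 1 \<or> x \<le> 8/9"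
  using ratios2_large[of x] by fastforce

text \<open>A product of two ratios in \<open>ratios2\<close> other than 1 exceeds 2/3 only if both exceed 3/4,
  which leaves finitely many cases.\<close>

lemma ratios2_both_large:
  assumes "x \<in> ratios2" "y \<in> ratios2" "2/3 < x * y" "x \<noteq> 1" "y \<noteq> 1"
  shows "3/4 < x" "3/4 < y"
proof -
  have "x \<le> 8/9" "y \<le> 8/9" using ratios2_le assms by auto
  moreover have "0 < x" "0 < y" using ratios2_pos assms by auto
  ultimately have "x * y \<le> x * (8/9)" "x * y \<le> (8/9) * y"
    by (simp_all only: mult_left_mono mult_right_mono less_imp_le)
  with assms(3) show "3/4 < x" "3/4 < y" by linarith+
qed

section \<open>Products of ratios, by residue classes\<close>

lemma ratios00_mult:
  assumes "x \<in> ratios0" "y \<in> ratios0" "2/3 < x * y"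
  shows "x * y \<in> ratios0"
proof (cases "x = 1 \<or> y = 1")
  case False
  then have "x \<in> {8/9, 64/81, 7/9}" "y \<in> {8/9, 64/81, 7/9}"
    using ratios2_both_large[of x y] ratios0_large[of x] ratios0_large[of y] assms ratios2I(1) by blast+
  \<comment> \<open>Only \<open>8/9 * 8/9 = 64/81\<close>, \<open>8/9 * 64/81 = 512/729\<close> and
    \<open>8/9 * 7/9 = 56/81\<close> exceed 2/3.\<close>
  moreover have "\<forall>x\<in>{8/9, 64/81, 7/9}. \<forall>y\<in>{8/9, 64/81, 7/9}. 2/3 < x * y \<longrightarrow> x * y \<in> ratios0"
    using ratios0I(3,4) ratios0_elems by simp
  ultimately show ?thesis using assms(3) by blast
qed (use assms in auto)

text \<open>Unless a factor is 1, the only surviving product with 5/6 is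
  \<open>8/9 * 5/6 = 20/27\<close>, which already belongs to class 0.\<close>

lemma ratios02_mult:
  assumes "x \<in> ratios0" "y \<in> ratios2" "2/3 < x * y"
  shows "x * y \<in> ratios2"
proof (cases "x = 1 \<or> y = 1")
  case False
  then have "x \<in> {8/9, 64/81, 7/9}" "y \<in> {8/9, 5/6, 64/81, 7/9}"
    using ratios2_both_large[of x y] ratios0_large[of x] ratios2_large[of y] assms ratios2I(1) by blast+
  moreover have "\<forall>x\<in>{8/9, 64/81, 7/9}. \<forall>y\<in>{8/9, 5/6, 64/81, 7/9}. 2/3 < x * y \<longrightarrow> x * y \<in> ratios0"
    using ratios0I(3,4) ratios0_elems by simp
  ultimately show ?thesis using assms(3) ratios2I(1) by blast
qed (use assms ratios2I(1) in auto)

text \<open>The target is class 1 with its higher threshold. If no factor is 1, only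
  \<open>8/9 * 8/9 = 64/81\<close> survives; otherwise the product is one of the five large ratios
  of class 2, which all occur in class 1.\<close>

lemma ratios22_mult:
  assumes "x \<in> ratios2" "y \<in> ratios2" "3/4 < x * y"
  shows "x * y \<in> ratios1"
proof (cases "x = 1 \<or> y = 1")
  case True
  then show ?thesis
    using ratios2_large_in_ratios1[of "x * y"] assms by auto
next
  case False
  moreover from assms(3) have "2/3 < x * y" by simp
  ultimately have "x \<in> {8/9, 5/6, 64/81, 7/9}" "y \<in> {8/9, 5/6, 64/81, 7/9}"
    using ratios2_both_large[of x y] ratios2_large[of x] ratios2_large[of y] assms by blast+
  moreover have "\<forall>x\<in>{8/9, 5/6, 64/81, 7/9}. \<forall>y\<in>{8/9, 5/6, 64/81, 7/9}.
      3/4 < x * y \<longrightarrow> x * y \<in> ratios1"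
    using ratios1I(3) by simp
  ultimately show ?thesis using assms(3) by blast
qed

text \<open>If both factors are at most 8/9, each must exceed \<open>(3/4) / (8/9) = 27/32\<close>,
  which lies beyond 5/6. The only ratio left below 1 is 8/9.\<close>

lemma ratios1_both_large:
  assumes "x \<in> ratios2 \<union> ratios1" "y \<in> ratios1" "3/4 < x * y" "x \<noteq> 1" "y \<noteq> 1"
  shows "x = 8/9" "y = 8/9"
proof -
  have y: "y = 8/9 \<or> y \<le> 5/6"
    using ratios1_large[of y] assms by blast
  have "x \<le> 8/9"
    using ratios2_le[of x] ratios1_large[of x] assms by fastforce
  moreover have "0 < x" "0 < y" using ratios2_pos ratios1_pos assms by auto
  moreover have "y \<le> 8/9" using y by auto
  ultimately have "x * y \<le> x * (8/9)" "x * y \<le> (8/9) * y"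
    by (simp_all only: mult_left_mono mult_right_mono less_imp_le)
  with assms(3) have gt: "5/6 < x" "5/6 < y" by linarith+
  with y show "y = 8/9" by linarith
  have "x \<in> {1, 8/9, 5/6, 64/81, 7/9} \<or> x = 8/9 \<or> x \<le> 5/6"
    using ratios2_large[of x] ratios1_large[of x] assms(1,4) gt(1) by fastforce
  with gt(1) assms(4) show "x = 8/9" by auto
qed

lemma ratios01_mult:
  assumes "x \<in> ratios0" "y \<in> ratios1" "3/4 < x * y"
  shows "x * y \<in> ratios1"
proof -
  consider "x = 1" | "y = 1" | "x = 8/9" "y = 8/9"
    using ratios1_both_large[of x y] ratios2I(1) assms by blast
  then show ?thesis
  proof cases
    case 2
    then show ?thesis using ratios2_large_in_ratios1[of x] ratios2I(1) assms by simp
  next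
    case 3
    show ?thesis unfolding 3 using ratios1I(3) by simp
  qed (use assms in simp)
qed

text \<open>The origin of the family \<open>2/3 + 2/3^n\<close>: a ratio of class 1 times the defect
  8/9 from \<open>emax_mult\<close>, which carries 3/4 to 2/3.\<close>

lemma ratios1_scaled:
  assumes "x \<in> ratios1"
  shows "8/9 * x \<in> ratios0"
proof -
  have "8/9 * (3/4 + 1/(4 * 3^n)) = (2/3 + 2/3^(n + 2) :: rat)" for n
    by (simp add: field_simps)
  then have "8/9 * (3/4 + 1/(4 * 3^n)) \<in> ratios0" for n
    using ratios0I(1)[of "n + 2"] by (simp only:)
  moreover have "8/9 * (8/9) \<in> ratios0" "8/9 * (64/81) \<in> ratios0"
    using ratios0I(3,4) by simp_all
  ultimately show ?thesis using assms unfolding ratios1_def by blast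
qed

text \<open>After cancelling 8/9 the bound reads \<open>3/4 < x * y\<close>, so either a factor is 1
  or the result is \<open>(8/9)^3 = 512/729\<close>.\<close>

lemma ratios11_mult:
  assumes "x \<in> ratios1" "y \<in> ratios1" "2/3 < 8/9 * (x * y)"
  shows "8/9 * (x * y) \<in> ratios0"
proof -
  consider "x = 1" | "y = 1" | "x = 8/9" "y = 8/9"
    using ratios1_both_large[of x y] assms by fastforce
  then show ?thesis
  proof cases
    case 3
    show ?thesis unfolding 3 using ratios0I(4) by simp
  qed (use ratios1_scaled[of x] ratios1_scaled[of y] assms in auto)
qed

lemma ratios21_mult:
  assumes "x \<in> ratios2" "y \<in> ratios1" "2/3 < 8/9 * (x * y)"
  shows "8/9 * (x * y) \<in> ratios0"
proof -
  consider "x = 1" | "y = 1" | "x = 8/9" "y = 8/9"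
    using ratios1_both_large[of x y] assms by fastforce
  then show ?thesis
  proof cases
    case 2
    then show ?thesis using ratios2_large_in_ratios1[of x] ratios1_scaled[of x] assms by simp
  next
    case 3
    show ?thesis unfolding 3 using ratios0I(4) by simp
  qed (use ratios1_scaled[of y] assms in simp)
qed

text \<open>The factor in \<open>z\<close> is \<open>emax i * emax j / emax (i + j)\<close> from
  \<open>emax_mult\<close>, so \<open>z\<close> is the ratio of the product of two values with
  ratios \<open>x\<close> and \<open>y\<close>.\<close>

lemma ratios_mult:
  assumes x: "x \<in> ratios i" and y: "y \<in> ratios j"
    and z: "z = (if i mod 3 = 1 \<and> j mod 3 \<noteq> 0 \<or> j mod 3 = 1 \<and> i mod 3 \<noteq> 0 then 8/9 else 1) * (x * y)"
    and gt: "threshold (i + j) < z"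
  shows "z \<in> ratios (i + j)"
proof -
  have "i mod 3 = 0 \<or> i mod 3 = 1 \<or> i mod 3 = 2" "j mod 3 = 0 \<or> j mod 3 = 1 \<or> j mod 3 = 2"
    by presburger+
  then consider "i mod 3 = 0" "j mod 3 = 0" "(i + j) mod 3 = 0" | "i mod 3 = 0" "j mod 3 = 1" "(i + j) mod 3 = 1"
    | "i mod 3 = 0" "j mod 3 = 2" "(i + j) mod 3 = 2" | "i mod 3 = 1" "j mod 3 = 0" "(i + j) mod 3 = 1"
    | "i mod 3 = 1" "j mod 3 = 1" "(i + j) mod 3 = 2" | "i mod 3 = 1" "j mod 3 = 2" "(i + j) mod 3 = 0"
    | "i mod 3 = 2" "j mod 3 = 0" "(i + j) mod 3 = 2" | "i mod 3 = 2" "j mod 3 = 1" "(i + j) mod 3 = 0"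
    | "i mod 3 = 2" "j mod 3 = 2" "(i + j) mod 3 = 1"
    by (elim disjE) (simp_all add: mod_add_eq[of i 3 j, symmetric])
  note cases = this
  note rules = ratios00_mult ratios02_mult ratios22_mult ratios01_mult ratios21_mult
    ratios02_mult[of y x] ratios01_mult[of y x] ratios21_mult[of y x] ratios11_mult[THEN ratios2I(1)]
  from cases show ?thesis
    unfolding z
    by cases (use x y gt[unfolded z] rules in
      \<open>simp_all add: ratios_def threshold_def mult.commute[of y x]\<close>)
qed

section \<open>Leading values have ratios in these sets\<close>

lemma emax_pred_add_1_ratio:
  assumes "2 \<le> k"
  shows "of_nat (emax (k - 1) + 1) / of_nat (emax k) \<in> ratios k"
proof -
  define m where "m = k div 3"
  consider "k = 3 * m" | "k = 3 * m + 1" | "k = 3 * m + 2"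
    unfolding m_def by linarith
  then show ?thesis
  proof cases
    case 1
    then obtain l where l: "m = Suc l" using assms by (cases m) auto
    have "k - 1 = 3 * l + 2" using 1 l by simp
    then have "emax (k - 1) = 2 * 3 ^ l" "emax k = 3 * 3 ^ l"
      by (simp_all only: 1 l emax_mult3 emax_mult3_plus2 power_Suc)
    moreover have "k mod 3 = 0" using 1 by simp
    ultimately show ?thesis
      using l ratios0I(2)[of m] by (simp add: ratios_def field_simps)
  next
    case 2
    then obtain l where l: "m = Suc l" using assms by (cases m) auto
    have "k = 3 * l + 4" "k - 1 = 3 * m" using 2 l by simp_all
    then have "emax (k - 1) = 3 * 3 ^ l" "emax k = 4 * 3 ^ l"
      by (simp_all only: l emax_mult3 emax_mult3_plus4 power_Suc)
    moreover have "k mod 3 = 1" using 2 by simp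
    ultimately show ?thesis
      using ratios1I(1)[of l] by (simp add: ratios_def field_simps)
  next
    case 3
    show ?thesis
    proof (cases m)
      case 0
      \<comment> \<open>Here \<open>k = 2\<close>, and the ratio is
        \<open>(1 + 1) / 2 = 1\<close>.\<close>
      then show ?thesis using 3 ratios0_elems(1) ratios2I(1) by (simp add: ratios_def emax_small numeral_2_eq_2)
    next
      case (Suc l)
      have "k - 1 = 3 * l + 4" using 3 Suc by simp
      then have "emax (k - 1) = 4 * 3 ^ l" "emax k = 2 * (3 * 3 ^ l)"
        by (simp_all only: 3 Suc emax_mult3_plus2 emax_mult3_plus4 power_Suc)
      moreover have "k mod 3 = 2" using 3 by presburger
      ultimately show ?thesis
        using Suc ratios2I(2)[of m] by (simp add: ratios_def field_simps)
    qed
  qed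
qed

lemma leading_ratio:
  assumes "2 \<le> num_ones t" "emax (num_ones t - 1) < expr_val t"
  shows "of_nat (expr_val t) / of_nat (emax (num_ones t)) \<in> ratios (num_ones t)"
  using assms
proof (induction t)
  case (Add s t)
  let ?i = "num_ones s" and ?j = "num_ones t"
  have "expr_val s + expr_val t \<le> emax ?i + emax ?j"
    by (intro add_mono expr_val_le_emax)
  also have "\<dots> \<le> emax (?i + ?j - 1) + 1"
    by (intro emax_add_le num_ones_pos)
  \<comment> \<open>Being leading is the matching lower bound, so both estimates are
    equalities.\<close>
  finally have "expr_val (Add s t) = emax (num_ones (Add s t) - 1) + 1"
    using Add.prems by simp
  then show ?case using emax_pred_add_1_ratio[OF Add.prems(1)] by metis
next
  case (Mul s t)
  let ?i = "num_ones s" and ?j = "num_ones t"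
  have pos: "1 \<le> ?i" "1 \<le> ?j" by (rule num_ones_pos)+
  have le: "expr_val s \<le> emax ?i" "expr_val t \<le> emax ?j" by (rule expr_val_le_emax)+
  have gt: "emax (?i + ?j - 1) < expr_val s * expr_val t" using Mul.prems by simp
  \<comment> \<open>A factor with a single one has value 1 and wastes that one, so the product would
    be at most \<open>emax (?i + ?j - 1)\<close>.\<close>
  have ij: "2 \<le> ?i" "2 \<le> ?j"
  proof -
    have "?i \<noteq> 1"
    proof
      assume "?i = 1"
      then have "expr_val s = 1" using le(1) expr_val_pos[of s] by simp
      with gt le \<open>?i = 1\<close> show False by simp
    qed
    moreover have "?j \<noteq> 1"
    proof
      assume "?j = 1"
      then have "expr_val t = 1" using le(2) expr_val_pos[of t] by simp
      with gt le \<open>?j = 1\<close> show False by simp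
    qed
    ultimately show "2 \<le> ?i" "2 \<le> ?j" using pos by auto
  qed
  \<comment> \<open>By supermultiplicativity a left factor that is not leading would keep the
    product within \<open>emax (?i + ?j - 1)\<close>. The right factor is treated in the same way
    below.\<close>
  have "emax (?i - 1) * expr_val t < expr_val s * expr_val t"
  proof -
    have "emax (?i - 1) * expr_val t \<le> emax (?i - 1) * emax ?j" using le by simp
    also have "\<dots> \<le> emax (?i + ?j - 1)" using emax_mult_le[of "?i - 1" ?j] ij by simp
    finally show ?thesis using gt by (rule le_less_trans)
  qed
  then have "emax (?i - 1) < expr_val s" by simp
  with Mul.IH(1) ij
  have x: "of_nat (expr_val s) / of_nat (emax ?i) \<in> ratios ?i" (is "?x \<in> _")
    by simp
  have "expr_val s * emax (?j - 1) < expr_val s * expr_val t"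
  proof -
    have "expr_val s * emax (?j - 1) \<le> emax ?i * emax (?j - 1)" using le by simp
    also have "\<dots> \<le> emax (?i + ?j - 1)" using emax_mult_le[of ?i "?j - 1"] ij by simp
    finally show ?thesis using gt by (rule le_less_trans)
  qed
  then have "emax (?j - 1) < expr_val t" by simp
  with Mul.IH(2) ij
  have y: "of_nat (expr_val t) / of_nat (emax ?j) \<in> ratios ?j" (is "?y \<in> _")
    by simp
  let ?c = "if ?i mod 3 = 1 \<and> ?j mod 3 \<noteq> 0 \<or> ?j mod 3 = 1 \<and> ?i mod 3 \<noteq> 0 then 8/9 else 1 :: rat"
  let ?z = "of_nat (expr_val s * expr_val t) / of_nat (emax (?i + ?j)) :: rat"
  have epos: "0 < (of_nat (emax k) :: rat)" for k using emax_pos by simp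
  have "of_nat (9 * (emax ?i * emax ?j)) = (9 * ?c * of_nat (emax (?i + ?j)) :: rat)"
    unfolding emax_mult[OF ij] by simp
  then have c: "of_nat (emax ?i) * of_nat (emax ?j) = ?c * of_nat (emax (?i + ?j))" by simp
  have "?c * (?x * ?y) = ?c * of_nat (expr_val s * expr_val t) / (of_nat (emax ?i) * of_nat (emax ?j))"
    by simp
  also have "\<dots> = ?z" unfolding c by simp
  finally have z: "?z = ?c * (?x * ?y)" by simp
  have "threshold (?i + ?j) * of_nat (emax (?i + ?j)) = of_nat (emax (?i + ?j - 1))"
    using emax_pred[of "?i + ?j"] ij by simp
  also have "\<dots> < of_nat (expr_val s * expr_val t)" using gt of_nat_less_iff by blast
  finally have "threshold (?i + ?j) < ?z" using epos by (simp add: pos_less_divide_eq)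
  from ratios_mult[OF x y z this] show ?case by simp
qed simp

lemma leading_cpx_le_ratio:
  assumes "2 \<le> k" "n \<in> cpx_le k" "emax (k - 1) < n"
  obtains x where "x \<in> ratios k" "of_nat n = x * of_nat (emax k)"
proof -
  have "rep n k" using rep_cpx[of n] cpx_eq_if_leading[OF assms(1,3,2)] assms(2) by (auto simp: cpx_le_def)
  then obtain t where "expr_val t = n" "num_ones t = k" by (auto simp: rep_def)
  then have "of_nat n / of_nat (emax k) \<in> ratios k" using leading_ratio[of t] assms by simp
  moreover have "of_nat n = of_nat n / of_nat (emax k) * (of_nat (emax k) :: rat)" using emax_pos[of k] by simp
  ultimately show thesis using that by blast
qed

section \<open>Attained ratios\<close>

text \<open>Complexity \<open>k\<close> is not demanded; above the threshold it follows from
  \<open>cpx_eq_if_leading\<close>.\<close>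

definition attained :: "nat \<Rightarrow> rat \<Rightarrow> bool" where
  "attained k x \<longleftrightarrow> (\<exists>n. rep n k \<and> of_nat n = x * of_nat (emax k))"

lemma attainedI: "rep n k \<Longrightarrow> of_nat n = x * of_nat (emax k) \<Longrightarrow> attained k x"
  by (auto simp: attained_def)

text \<open>A factor 3 costs three ones and triples \<open>emax\<close> too, so a ratio once
  attained persists in its residue class.\<close>

lemma attained_add_mult3:
  assumes "attained k x" "2 \<le> k"
  shows "attained (k + 3 * j) x"
proof -
  have "emax (k + 3 * j) = emax k * 3 ^ j"
  proof (induction j)
    case (Suc j)
    then show ?case using emax_add_3[of "k + 3 * j"] assms(2) by (simp add: algebra_simps)
  qed simp
  moreover obtain n where "rep n k" "of_nat n = x * of_nat (emax k)"
    using assms(1) by (auto simp: attained_def)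
  ultimately show ?thesis
    using attainedI[OF rep_mult_power3[of n k j]] by simp
qed

lemma attained_mono:
  assumes "attained k x" "2 \<le> k" "k \<le> l" "k mod 3 = l mod 3"
  shows "attained l x"
proof -
  have "3 dvd l - k" using mod_eq_dvd_iff_nat[of k l 3] assms(3,4) by simp
  then obtain j where "l = k + 3 * j" using assms(3) by (metis dvdE le_add_diff_inverse)
  then show ?thesis using attained_add_mult3[OF assms(1,2)] by simp
qed

lemma attained_double:
  assumes "attained (3 * m) x"
  shows "attained (3 * m + 2) x"
proof -
  obtain n where "rep n (3 * m)" "of_nat n = x * of_nat (emax (3 * m))"
    using assms by (auto simp: attained_def)
  then show ?thesis
    using attainedI[OF rep_mult[OF _ rep_2], of n "3 * m" x]
    by (simp only: emax_mult3 emax_mult3_plus2 of_nat_mult)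
qed

lemma attained_1: "2 \<le> k \<Longrightarrow> attained k 1"
  by (rule attainedI[OF rep_emax]) auto

text \<open>The witness is twice the leading sum \<open>3 ^ (n - 1) + 1\<close> of class 1.\<close>

lemma attained_two_thirds_2:
  assumes "2 \<le> n"
  shows "attained (3 * n) (2/3 + 2/3^n)"
proof -
  obtain l where l: "n = Suc l" "1 \<le> l" using assms by (cases n) auto
  have "rep (2 * (3 ^ l + 1)) (2 + (3 * l + 1))"
    by (intro rep_mult rep_add rep_2 rep_1 rep_power3 l)
  also have "2 + (3 * l + 1) = 3 * n" by (simp add: l)
  finally show ?thesis
    by (rule attainedI) (simp only: emax_mult3, simp add: l field_simps)
qed

text \<open>Here and for the next two families the witness is the sum
  \<open>emax (k - 1) + 1\<close> itself.\<close>

lemma attained_two_thirds_1: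
  assumes "2 \<le> n"
  shows "attained (3 * n) (2/3 + 1/3^n)"
proof -
  obtain l where l: "n = Suc l" "1 \<le> l" using assms by (cases n) auto
  have "rep (2 * 3 ^ l + 1) ((2 + 3 * l) + 1)"
    by (intro rep_mult rep_add rep_2 rep_1 rep_power3 l)
  also have "(2 + 3 * l) + 1 = 3 * n" by (simp add: l)
  finally show ?thesis
    by (rule attainedI) (simp only: emax_mult3, simp add: l field_simps)
qed

lemma attained_two_thirds_half:
  assumes "1 \<le> n"
  shows "attained (3 * n + 2) (2/3 + 1/(2 * 3^n))"
proof -
  obtain l where l: "n = Suc l" using assms by (cases n) auto
  have "rep (2 ^ 2 * 3 ^ l + 1) ((2 * 2 + 3 * l) + 1)"
    \<comment> \<open>The exponent \<open>l\<close> may be 0, hence \<open>rep_mult_power3\<close>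
      applied to \<open>2 ^ 2\<close> rather than a representation of \<open>3 ^ l\<close>.\<close>
    by (intro rep_add rep_mult_power3 rep_1 rep_power2) simp
  also have "(2 * 2 + 3 * l) + 1 = 3 * n + 2" by (simp add: l)
  finally show ?thesis
    by (rule attainedI) (simp only: emax_mult3_plus2, simp add: l field_simps)
qed

lemma attained_three_quarters: "attained (3 * n + 4) (3/4 + 1/(4 * 3^n))"
proof -
  have "rep (3 ^ Suc n + 1) (3 * Suc n + 1)"
    by (intro rep_add rep_1 rep_power3) simp
  also have "3 * Suc n + 1 = 3 * n + 4" by simp
  finally show ?thesis
    by (rule attainedI) (simp only: emax_mult3_plus4, simp add: field_simps)
qed

text \<open>The powers \<open>2 ^ 6\<close>, \<open>2 ^ 9\<close>, \<open>2 ^ 5\<close> and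
  \<open>2 ^ 8\<close> account for the ratios outside the infinite families.\<close>

lemma attained_powers:
  "attained 12 (64/81)" "attained 18 (512/729)" "attained 10 (8/9)" "attained 16 (64/81)"
  using rep_power2[of 6] rep_power2[of 9] rep_power2[of 5] rep_power2[of 8]
    emax_mult3[of 4] emax_mult3[of 6] emax_mult3_plus4[of 2] emax_mult3_plus4[of 4]
    attainedI[of 64 12 "64/81"] attainedI[of 512 18 "512/729"] attainedI[of 32 10 "8/9"]
    attainedI[of 256 16 "64/81"]
  by simp_all

section \<open>Enumeration of the ratios\<close>

text \<open>In the tail, \<open>(r + 1) div 2\<close> is the \<open>n\<close> with
  \<open>r = 2 * n - 1\<close> or \<open>r = 2 * n\<close>.\<close>

definition tab0 :: "nat \<Rightarrow> rat \<times> nat" where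
  "tab0 r = (if r < 11
    then [(1, 3), (8/9, 6), (64/81, 12), (7/9, 12), (20/27, 12), (19/27, 12), (512/729, 18),
          (56/81, 18), (55/81, 18), (164/243, 18), (163/243, 18)] ! r
    else (2/3 + (if odd r then 2 else 1) / 3 ^ ((r + 1) div 2), 3 * ((r + 1) div 2)))"

text \<open>In the tail \<open>n = r div 3 + 1\<close>, and the numerator 3/2 over
  \<open>3^n\<close> gives \<open>1/(2 * 3^(n - 1))\<close>.\<close>

definition tab2 :: "nat \<Rightarrow> rat \<times> nat" where
  "tab2 r = (if r < 15
    then [(1, 2), (8/9, 8), (5/6, 8), (64/81, 14), (7/9, 14), (20/27, 14), (13/18, 14), (19/27, 14),
          (512/729, 20), (56/81, 20), (37/54, 20), (55/81, 20), (164/243, 20), (109/162, 20),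
          (163/243, 20)] ! r
    else (2/3 + (if r mod 3 = 0 then 2 else if r mod 3 = 1 then 3/2 else 1) / 3 ^ (r div 3 + 1),
          3 * (r div 3 + 1) + 2))"

definition tab1 :: "nat \<Rightarrow> rat \<times> nat" where
  "tab1 r = (if r < 6
    then [(1, 4), (8/9, 10), (5/6, 10), (64/81, 16), (7/9, 16), (41/54, 16)] ! r
    else (3/4 + 1 / (4 * 3 ^ (r - 2)), 3 * (r - 2) + 4))"

lemma tab0_entries:
  "tab0 0 = (1, 3)" "tab0 1 = (8/9, 6)" "tab0 2 = (64/81, 12)" "tab0 3 = (7/9, 12)"
  "tab0 4 = (20/27, 12)" "tab0 5 = (19/27, 12)" "tab0 6 = (512/729, 18)" "tab0 7 = (56/81, 18)"
  "tab0 8 = (55/81, 18)" "tab0 9 = (164/243, 18)" "tab0 10 = (163/243, 18)"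
  by (simp_all add: tab0_def)

lemma tab0_tail:
  assumes "6 \<le> n"
  shows "tab0 (2 * n - 1) = (2/3 + 2/3^n, 3 * n)" "tab0 (2 * n) = (2/3 + 1/3^n, 3 * n)"
  using assms by (auto simp: tab0_def)

lemma tab2_entries:
  "tab2 0 = (1, 2)" "tab2 1 = (8/9, 8)" "tab2 2 = (5/6, 8)" "tab2 3 = (64/81, 14)"
  "tab2 4 = (7/9, 14)" "tab2 5 = (20/27, 14)" "tab2 6 = (13/18, 14)" "tab2 7 = (19/27, 14)"
  "tab2 8 = (512/729, 20)" "tab2 9 = (56/81, 20)" "tab2 10 = (37/54, 20)" "tab2 11 = (55/81, 20)"
  "tab2 12 = (164/243, 20)" "tab2 13 = (109/162, 20)" "tab2 14 = (163/243, 20)"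
  by (simp_all add: tab2_def)

lemma tab2_tail:
  assumes "6 \<le> n"
  shows "tab2 (3 * n - 3) = (2/3 + 2/3^n, 3 * n + 2)"
    "tab2 (3 * n - 2) = (2/3 + 1/(2 * 3^(n - 1)), 3 * n + 2)"
    "tab2 (3 * n - 1) = (2/3 + 1/3^n, 3 * n + 2)"
proof -
  obtain l where l: "n = Suc l" "5 \<le> l" using assms by (cases n) auto
  then have "3 * n - 3 = 3 * l" "3 * n - 2 = 3 * l + 1" "3 * n - 1 = 3 * l + 2" by auto
  moreover have "(3 * l + 1) mod 3 = 1" "(3 * l + 2) mod 3 = 2" "(3 * l + 1) div 3 = l"
    "(3 * l + 2) div 3 = l" by presburger+
  ultimately show "tab2 (3 * n - 3) = (2/3 + 2/3^n, 3 * n + 2)"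
    "tab2 (3 * n - 2) = (2/3 + 1/(2 * 3^(n - 1)), 3 * n + 2)"
    "tab2 (3 * n - 1) = (2/3 + 1/3^n, 3 * n + 2)"
    using l(2) by (simp_all add: tab2_def l(1))
qed

lemma tab1_entries:
  "tab1 0 = (1, 4)" "tab1 1 = (8/9, 10)" "tab1 2 = (5/6, 10)" "tab1 3 = (64/81, 16)"
  "tab1 4 = (7/9, 16)" "tab1 5 = (41/54, 16)"
  by (simp_all add: tab1_def)

lemma tab1_tail: "4 \<le> n \<Longrightarrow> tab1 (n + 2) = (3/4 + 1/(4 * 3^n), 3 * n + 4)"
  by (simp add: tab1_def)

lemma table0_tab0: "table0 tab0"
  unfolding table0_def using tab0_entries tab0_tail by simp

lemma table2_tab2: "table2 tab2"
  unfolding table2_def using tab2_entries tab2_tail by simp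

lemma table1_tab1: "table1 tab1"
  unfolding table1_def using tab1_entries tab1_tail by simp

section \<open>Order and completeness of the tables\<close>

lemma tab0_cases:
  fixes r :: nat
  obtains "r \<in> {0, 1, 2, 3, 4, 5, 6, 7, 8, 9, 10}" | n where "6 \<le> n" "r = 2 * n - 1"
  | n where "6 \<le> n" "r = 2 * n"
proof (cases "r < 11")
  case True
  then have "r \<in> {0, 1, 2, 3, 4, 5, 6, 7, 8, 9, 10}"
    unfolding insert_iff empty_iff by presburger
  then show ?thesis by (rule that(1))
next
  case False
  then show ?thesis using that(2)[of "(r + 1) div 2"] that(3)[of "r div 2"]
    by (cases "odd r") auto
qed

lemma tab2_cases:
  fixes r :: nat
  obtains "r \<in> {0, 1, 2, 3, 4, 5, 6, 7, 8, 9, 10, 11, 12, 13, 14}" | n where "6 \<le> n" "r = 3 * n - 3"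
  | n where "6 \<le> n" "r = 3 * n - 2" | n where "6 \<le> n" "r = 3 * n - 1"
proof (cases "r < 15")
  case True
  then have "r \<in> {0, 1, 2, 3, 4, 5, 6, 7, 8, 9, 10, 11, 12, 13, 14}"
    unfolding insert_iff empty_iff by presburger
  then show ?thesis by (rule that(1))
next
  case False
  define n where "n = r div 3 + 1"
  have "6 \<le> n" using False by (simp add: n_def)
  moreover have "r = 3 * n - 3 \<or> r = 3 * n - 2 \<or> r = 3 * n - 1" unfolding n_def by presburger
  ultimately show ?thesis using that(2-4) by blast
qed

lemma tab1_cases:
  fixes r :: nat
  obtains "r \<in> {0, 1, 2, 3, 4, 5}" | n where "4 \<le> n" "r = n + 2"
proof (cases "r < 6")
  case True
  then have "r \<in> {0, 1, 2, 3, 4, 5}"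
    unfolding insert_iff empty_iff by presburger
  then show ?thesis by (rule that(1))
next
  case False
  then show ?thesis using that(2)[of "r - 2"] by simp
qed

text \<open>The decreasing ratios make the row number a rank; the nondecreasing bounds let the bound
  of row \<open>r\<close> serve all earlier rows.\<close>

lemma tab0_Suc:
  shows "fst (tab0 (Suc r)) < fst (tab0 r)" "snd (tab0 r) \<le> snd (tab0 (Suc r))"
proof -
  have "fst (tab0 (Suc r)) < fst (tab0 r) \<and> snd (tab0 r) \<le> snd (tab0 (Suc r))"
  proof (cases r rule: tab0_cases)
    case 1
    \<comment> \<open>The successor of row 10 is the first row of the tail.\<close>
    moreover have "tab0 11 = (2/3 + 2/3^6, 18)" using tab0_tail(1)[of 6] by simp
    ultimately show ?thesis
      by (elim insertE emptyE) (simp_all add: tab0_entries[simplified] tab0_entries(3)[unfolded numeral_2_eq_2])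
  next
    case (2 n)
    then have "Suc r = 2 * n" by simp
    with 2 show ?thesis using tab0_tail[of n] by (simp add: divide_strict_right_mono)
  next
    case (3 n)
    then have "Suc r = 2 * Suc n - 1" by simp
    with 3 show ?thesis using tab0_tail[of n] tab0_tail[of "Suc n"] by (simp add: field_simps)
  qed
  then show "fst (tab0 (Suc r)) < fst (tab0 r)" "snd (tab0 r) \<le> snd (tab0 (Suc r))" by auto
qed

lemma tab2_Suc:
  shows "fst (tab2 (Suc r)) < fst (tab2 r)" "snd (tab2 r) \<le> snd (tab2 (Suc r))"
proof -
  have "fst (tab2 (Suc r)) < fst (tab2 r) \<and> snd (tab2 r) \<le> snd (tab2 (Suc r))"
  proof (cases r rule: tab2_cases)
    case 1
    moreover have "tab2 15 = (2/3 + 2/3^6, 20)" using tab2_tail(1)[of 6] by simp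
    ultimately show ?thesis
      by (elim insertE emptyE) (simp_all add: tab2_entries[simplified] tab2_entries(3)[unfolded numeral_2_eq_2])
  next
    case (2 n)
    then obtain l where l: "n = Suc l" by (cases n) auto
    from 2 have "Suc r = 3 * n - 2" by simp
    with 2 show ?thesis using tab2_tail[of n] by (simp add: l field_simps del: mult_Suc_right)
  next
    case (3 n)
    then obtain l where l: "n = Suc l" by (cases n) auto
    from 3 have "Suc r = 3 * n - 1" by simp
    with 3 show ?thesis using tab2_tail[of n] by (simp add: l field_simps del: mult_Suc_right)
  next
    case (4 n)
    then have "Suc r = 3 * Suc n - 3" by simp
    with 4 show ?thesis using tab2_tail[of n] tab2_tail[of "Suc n"] by (simp add: field_simps)
  qed
  then show "fst (tab2 (Suc r)) < fst (tab2 r)" "snd (tab2 r) \<le> snd (tab2 (Suc r))" by auto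
qed

lemma tab1_Suc:
  shows "fst (tab1 (Suc r)) < fst (tab1 r)" "snd (tab1 r) \<le> snd (tab1 (Suc r))"
proof -
  have "fst (tab1 (Suc r)) < fst (tab1 r) \<and> snd (tab1 r) \<le> snd (tab1 (Suc r))"
  proof (cases r rule: tab1_cases)
    case 1
    moreover have "tab1 6 = (3/4 + 1/(4 * 3^4), 16)" using tab1_tail[of 4] by simp
    ultimately show ?thesis
      by (elim insertE emptyE) (simp_all add: tab1_entries[simplified] tab1_entries(3)[unfolded numeral_2_eq_2])
  next
    case (2 n)
    then have "Suc r = Suc n + 2" by simp
    with 2 show ?thesis using tab1_tail[of n] tab1_tail[of "Suc n"] by (simp add: field_simps)
  qed
  then show "fst (tab1 (Suc r)) < fst (tab1 r)" "snd (tab1 r) \<le> snd (tab1 (Suc r))" by auto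
qed

lemma tab0_gt: "2/3 < fst (tab0 r)"
proof (cases r rule: tab0_cases)
  case 1
  then show ?thesis by (elim insertE emptyE) (simp_all add: tab0_entries[simplified])
next
  case (2 n)
  then show ?thesis using tab0_tail[of n] by simp
next
  case (3 n)
  then show ?thesis using tab0_tail[of n] by simp
qed

lemma tab2_gt: "2/3 < fst (tab2 r)"
proof (cases r rule: tab2_cases)
  case 1
  then show ?thesis by (elim insertE emptyE) (simp_all add: tab2_entries[simplified])
next
  case (2 n)
  then show ?thesis using tab2_tail[of n] by simp
next
  case (3 n)
  then show ?thesis using tab2_tail[of n] by simp
next
  case (4 n)
  then show ?thesis using tab2_tail[of n] by simp
qed

lemma tab1_gt: "3/4 < fst (tab1 r)"
proof (cases r rule: tab1_cases)
  case 1
  then show ?thesis by (elim insertE emptyE) (simp_all add: tab1_entries[simplified])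
next
  case (2 n)
  then show ?thesis using tab1_tail[of n] by simp
qed

text \<open>No ratio is missed: members of the families with small \<open>n\<close> are among the
  individually listed entries, the others form the tail.\<close>

lemma ratios0_subset_tab0: "ratios0 \<subseteq> range (\<lambda>r. fst (tab0 r))"
proof -
  define R where "R = range (\<lambda>r. fst (tab0 r))"
  have R: "fst (tab0 r) \<in> R" for r by (simp add: R_def)
  have entries: "{1, 8/9, 64/81, 7/9, 20/27, 19/27, 512/729, 56/81, 55/81, 164/243, 163/243} \<subseteq> R"
    using R[of 0] R[of 1] R[of 2] R[of 3] R[of 4] R[of 5] R[of 6] R[of 7] R[of 8] R[of 9] R[of 10]
    by (simp add: tab0_entries[simplified])
  have "2/3 + 2/3^n \<in> R" if "2 \<le> n" for n
  proof (cases "6 \<le> n")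
    case True
    then show ?thesis using R[of "2 * n - 1"] tab0_tail(1)[of n] by simp
  next
    case False
    with that have "n \<in> {2, 3, 4, 5}" by force
    then show ?thesis using entries by (elim insertE emptyE) simp_all
  qed
  moreover have "2/3 + 1/3^n \<in> R" if "1 \<le> n" for n
  proof (cases "6 \<le> n")
    case True
    then show ?thesis using R[of "2 * n"] tab0_tail(2)[of n] by simp
  next
    case False
    with that have "n \<in> {1, 2, 3, 4, 5}" by force
    then show ?thesis using entries by (elim insertE emptyE) simp_all
  qed
  ultimately show ?thesis using entries unfolding ratios0_def R_def[symmetric] by blast
qed

lemma ratios2_subset_tab2: "ratios2 \<subseteq> range (\<lambda>r. fst (tab2 r))"
proof -
  define R where "R = range (\<lambda>r. fst (tab2 r))"
  have R: "fst (tab2 r) \<in> R" for r by (simp add: R_def)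
  have entries: "{1, 8/9, 5/6, 64/81, 7/9, 20/27, 13/18, 19/27, 512/729, 56/81, 37/54, 55/81, 164/243,
      109/162, 163/243} \<subseteq> R"
    using R[of 0] R[of 1] R[of 2] R[of 3] R[of 4] R[of 5] R[of 6] R[of 7] R[of 8] R[of 9] R[of 10]
      R[of 11] R[of 12] R[of 13] R[of 14]
    by (simp add: tab2_entries[simplified])
  have "2/3 + 2/3^n \<in> R" if "2 \<le> n" for n
  proof (cases "6 \<le> n")
    case True
    then show ?thesis using R[of "3 * n - 3"] tab2_tail(1)[of n] by simp
  next
    case False
    with that have "n \<in> {2, 3, 4, 5}" by force
    then show ?thesis using entries by (elim insertE emptyE) simp_all
  qed
  moreover have "2/3 + 1/3^n \<in> R" if "1 \<le> n" for n
  proof (cases "6 \<le> n")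
    case True
    then show ?thesis using R[of "3 * n - 1"] tab2_tail(3)[of n] by simp
  next
    case False
    with that have "n \<in> {1, 2, 3, 4, 5}" by force
    then show ?thesis using entries by (elim insertE emptyE) simp_all
  qed
  \<comment> \<open>The tail lists this family with exponent \<open>n - 1\<close>, so it takes over
    at 5 instead of 6.\<close>
  moreover have "2/3 + 1/(2 * 3^n) \<in> R" if "1 \<le> n" for n
  proof (cases "5 \<le> n")
    case True
    then show ?thesis using R[of "3 * Suc n - 2"] tab2_tail(2)[of "Suc n"] by simp
  next
    case False
    with that have "n \<in> {1, 2, 3, 4}" by force
    then show ?thesis using entries by (elim insertE emptyE) simp_all
  qed
  ultimately show ?thesis
    using entries unfolding ratios2_def ratios0_def R_def[symmetric] by blast
qed

lemma ratios1_subset_tab1: "ratios1 \<subseteq> range (\<lambda>r. fst (tab1 r))"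
proof -
  define R where "R = range (\<lambda>r. fst (tab1 r))"
  have R: "fst (tab1 r) \<in> R" for r by (simp add: R_def)
  have entries: "{1, 8/9, 5/6, 64/81, 7/9, 41/54} \<subseteq> R"
    using R[of 0] R[of 1] R[of 2] R[of 3] R[of 4] R[of 5] by (simp add: tab1_entries[simplified])
  have "3/4 + 1/(4 * 3^n) \<in> R" for n
  proof (cases "4 \<le> n")
    case True
    then show ?thesis using R[of "n + 2"] tab1_tail[of n] by simp
  next
    case False
    then have "n \<in> {0, 1, 2, 3}" by force
    then show ?thesis using entries by (elim insertE emptyE) simp_all
  qed
  then show ?thesis using entries unfolding ratios1_def R_def[symmetric] by blast
qed

text \<open>Some entries are attained before the bound in the table: in all three tables
  \<open>K\<close> is the running maximum of these numbers of ones. For instance, 7/9 is attained at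
  6, but the row before it, 64/81, has 12.\<close>

lemma attained_entries0:
  "attained 3 1" "attained 6 (8/9)" "attained 12 (64/81)" "attained 6 (7/9)" "attained 9 (20/27)"
  "attained 9 (19/27)" "attained 18 (512/729)" "attained 12 (56/81)" "attained 12 (55/81)"
  "attained 15 (164/243)" "attained 15 (163/243)"
  using attained_1[of 3] attained_powers(1,2) attained_two_thirds_2[of 2] attained_two_thirds_2[of 3]
    attained_two_thirds_2[of 4] attained_two_thirds_2[of 5] attained_two_thirds_1[of 2]
    attained_two_thirds_1[of 3] attained_two_thirds_1[of 4] attained_two_thirds_1[of 5]
  by simp_all

lemma attained_tab0:
  assumes "snd (tab0 r) \<le> k" "k mod 3 = 0"
  shows "attained k (fst (tab0 r))"
proof (cases r rule: tab0_cases)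
  case 1
  then show ?thesis
    using assms by (elim insertE emptyE)
      (simp_all add: tab0_entries[simplified] attained_entries0[THEN attained_mono])
next
  case (2 n)
  then show ?thesis
    using attained_mono[OF attained_two_thirds_2[of n], of k] assms tab0_tail[of n] by simp
next
  case (3 n)
  then show ?thesis
    using attained_mono[OF attained_two_thirds_1[of n], of k] assms tab0_tail[of n] by simp
qed

lemma attained_entries2:
  "attained 2 1" "attained 8 (8/9)" "attained 5 (5/6)" "attained 14 (64/81)" "attained 8 (7/9)"
  "attained 11 (20/27)" "attained 8 (13/18)" "attained 11 (19/27)" "attained 20 (512/729)"
  "attained 14 (56/81)" "attained 11 (37/54)" "attained 14 (55/81)" "attained 17 (164/243)"
  "attained 14 (109/162)" "attained 17 (163/243)"
  using attained_1[of 2] attained_entries0 attained_double[of 2] attained_double[of 3]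
    attained_double[of 4] attained_double[of 5] attained_double[of 6] attained_two_thirds_half[of 1]
    attained_two_thirds_half[of 2] attained_two_thirds_half[of 3] attained_two_thirds_half[of 4]
  by simp_all

lemma attained_tab2:
  assumes "snd (tab2 r) \<le> k" "k mod 3 = 2"
  shows "attained k (fst (tab2 r))"
proof -
  have mod: "Suc (Suc (3 * n)) mod 3 = 2" for n :: nat by presburger
  show ?thesis
  proof (cases r rule: tab2_cases)
    case 1
    then show ?thesis
      using assms by (elim insertE emptyE)
        (simp_all add: tab2_entries[simplified] attained_entries2[THEN attained_mono])
  next
    case (2 n)
    then show ?thesis
      using attained_mono[OF attained_double[OF attained_two_thirds_2[of n]], of k] assms
        tab2_tail[of n] mod by simp
  next
    case (3 n)
    \<comment> \<open>The exponent in this family is \<open>l = n - 1\<close>, so the witness has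
      \<open>3 * n - 1\<close> ones, three fewer than the bound.\<close>
    then obtain l where l: "n = Suc l" "1 \<le> l" by (cases n) auto
    then show ?thesis
      using 3 attained_mono[OF attained_two_thirds_half[of l], of k] assms
        tab2_tail(2)[of n] mod by simp
  next
    case (4 n)
    then show ?thesis
      using attained_mono[OF attained_double[OF attained_two_thirds_1[of n]], of k] assms
        tab2_tail[of n] mod by simp
  qed
qed

lemma attained_entries1:
  "attained 4 1" "attained 10 (8/9)" "attained 7 (5/6)" "attained 16 (64/81)" "attained 10 (7/9)"
  "attained 13 (41/54)"
  using attained_1[of 4] attained_powers(3,4) attained_three_quarters[of 1]
    attained_three_quarters[of 2] attained_three_quarters[of 3]
  by simp_all

lemma attained_tab1:
  assumes "snd (tab1 r) \<le> k" "k mod 3 = 1"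
  shows "attained k (fst (tab1 r))"
proof (cases r rule: tab1_cases)
  case 1
  then show ?thesis
    using assms by (elim insertE emptyE)
      (simp_all add: tab1_entries[simplified] attained_entries1[THEN attained_mono])
next
  case (2 n)
  then show ?thesis
    using attained_mono[OF attained_three_quarters[of n], of k] assms tab1_tail[of n] by simp
qed

section \<open>Ranks\<close>

text \<open>Justifies the definite description in \<open>Er\<close>: the larger of two candidates
  has strictly fewer elements above it.\<close>

lemma rth_largest_unique:
  assumes "rth_largest A r m" "rth_largest A r n"
  shows "m = n"
proof -
  have "\<not> m < n" if "rth_largest A r m" "rth_largest A r n" for m n
  proof
    assume "m < n"
    then have "{l \<in> A. n < l} \<subset> {l \<in> A. m < l}" using that(2) by (auto simp: rth_largest_def)
    moreover have "finite {l \<in> A. m < l}" using that(1) by (simp add: rth_largest_def)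
    ultimately have "card {l \<in> A. n < l} < card {l \<in> A. m < l}" by (rule psubset_card_mono[rotated])
    with that show False by (simp add: rth_largest_def)
  qed
  with assms show ?thesis by (meson linorder_neqE_nat)
qed

lemma Er_eqI: "rth_largest (cpx_le k) r n \<Longrightarrow> Er r k = n"
  unfolding Er_def using rth_largest_unique by (blast intro: the_equality)

text \<open>The attained values \<open>v 0 > v 1 > ... > v r\<close> are the \<open>r + 1\<close>
  largest numbers: anything above \<open>v r\<close> is leading, so its ratio is some
  \<open>f s\<close>, and monotonicity gives \<open>s < r\<close>.\<close>

lemma Er_from_enumeration:
  assumes k: "2 \<le> k"
    and decreasing: "\<And>r. f (Suc r) < f r"
    and covers: "ratios k \<subseteq> range f"
    and gt: "\<And>r. threshold k < f r"
    and attained: "\<And>s. s \<le> r \<Longrightarrow> attained k (f s)"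
  shows "rth_largest (cpx_le k) r (Er r k) \<and>
    of_nat (Er r k) = f r * of_nat (E k) \<and>
    Er r k > E (k - 1) \<and>
    cpx (Er r k) = k \<and>
    rth_largest (cpx_eq k) r (Er r k)"
proof -
  have less: "f t < f s \<longleftrightarrow> s < t" for s t
  proof -
    have "f t < f s" if "s < t" for s t
      \<comment> \<open>The negation turns the decreasing sequence into an increasing one.\<close>
      using lift_Suc_mono_less[of "\<lambda>n. - f n" s t] decreasing that by simp
    then show ?thesis by (metis linorder_neqE_nat order_less_asym order_less_irrefl)
  qed
  have epos: "0 < (of_nat (emax k) :: rat)" using emax_pos by simp
  obtain v where v: "\<And>s. s \<le> r \<Longrightarrow> rep (v s) k \<and> of_nat (v s) = f s * of_nat (emax k)"
    using attained unfolding attained_def by metis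
  have v_less: "v t < v s \<longleftrightarrow> s < t" if "s \<le> r" "t \<le> r" for s t
  proof -
    have "v t < v s \<longleftrightarrow> f t * of_nat (emax k) < f s * of_nat (emax k)"
      using v[OF that(1)] v[OF that(2)] by (metis of_nat_less_iff)
    then show ?thesis using less epos by simp
  qed
  have mem: "v s \<in> cpx_le k" if "s \<le> r" for s
    using v[OF that] rep_pos cpx_le_of_rep by (auto simp: cpx_le_def)
  \<comment> \<open>The inequality \<open>emax_pred_le\<close> also covers \<open>k = 2\<close>,
    where the quotient is below the threshold.\<close>
  have "of_nat (emax (k - 1)) < (of_nat (v r) :: rat)"
    using emax_pred_le[OF k] mult_strict_right_mono[OF gt[of r] epos] v[of r] by simp
  then have leading: "emax (k - 1) < v r" by simp
  have "{m \<in> cpx_le k. v r < m} = v ` {..<r}"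
  proof (intro equalityI subsetI)
    fix m assume "m \<in> {m \<in> cpx_le k. v r < m}"
    then have m: "m \<in> cpx_le k" "v r < m" by auto
    from m(2) leading have "emax (k - 1) < m" by simp
    then obtain x where x: "x \<in> ratios k" "of_nat m = x * of_nat (emax k)"
      by (rule leading_cpx_le_ratio[OF k m(1)])
    then obtain s where s: "x = f s" using covers by auto
    have "f r * of_nat (emax k) = of_nat (v r)" using v[of r] by simp
    also have "\<dots> < of_nat m" using m(2) by simp
    also have "\<dots> = f s * of_nat (emax k)" using x(2) s by simp
    finally have "s < r" using epos less by simp
    moreover have "(of_nat m :: rat) = of_nat (v s)" using v[of s] x(2) s \<open>s < r\<close> by simp
    ultimately show "m \<in> v ` {..<r}" by auto
  qed (use mem v_less in auto)
  moreover have "inj_on v {..<r}"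
  proof (rule inj_onI)
    fix s t assume "s \<in> {..<r}" "t \<in> {..<r}" "v s = v t"
    then have "\<not> s < t" "\<not> t < s" using v_less[of s t] v_less[of t s] by auto
    then show "s = t" by simp
  qed
  ultimately have card: "finite {m \<in> cpx_le k. v r < m}" "card {m \<in> cpx_le k. v r < m} = r"
    by (simp_all add: card_image)
  \<comment> \<open>Above \<open>emax (k - 1)\<close>, complexity at most \<open>k\<close> means
    complexity exactly \<open>k\<close>, so both notions of rank agree.\<close>
  have "{m \<in> cpx_eq k. v r < m} = {m \<in> cpx_le k. v r < m}"
    using cpx_eq_if_leading[OF k] leading by (fastforce simp: cpx_eq_def cpx_le_def)
  with card mem[of r] have ranks: "rth_largest (cpx_le k) r (v r)"
      "cpx (v r) = k \<Longrightarrow> rth_largest (cpx_eq k) r (v r)"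
    by (simp_all add: rth_largest_def) (simp_all add: cpx_le_def cpx_eq_def)
  have "cpx (v r) = k" using cpx_eq_if_leading[OF k leading] mem by simp
  moreover have "E k = emax k" "E (k - 1) = emax (k - 1)" using k by (simp_all add: E_eq_emax)
  moreover have "Er r k = v r" using ranks(1) by (rule Er_eqI)
  ultimately show ?thesis
    using ranks leading v[of r] by simp
qed

theorem theorem1p12:
  shows "\<exists>(h :: nat \<Rightarrow> nat \<Rightarrow> rat) (K :: nat \<Rightarrow> nat \<Rightarrow> nat).
    table0 (\<lambda>r. (h r 0, K r 0)) \<and>
    table2 (\<lambda>r. (h r 2, K r 2)) \<and>
    table1 (\<lambda>r. (h r 1, K r 1)) \<and>
    (\<forall>r. \<forall>a\<in>{0, 1, 2}.
      K r a > 1 \<and>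
      (\<forall>k\<ge>K r a. [k = a] (mod 3) \<longrightarrow>
        rth_largest (cpx_le k) r (Er r k) \<and>
        of_nat (Er r k) = h r a * of_nat (E k) \<and>
        Er r k > E (k - 1) \<and>
        cpx (Er r k) = k \<and>
        rth_largest (cpx_eq k) r (Er r k)))"
proof -
  define tab :: "nat \<Rightarrow> nat \<Rightarrow> rat \<times> nat" where
    "tab a = (if a = 0 then tab0 else if a = 1 then tab1 else tab2)" for a
  have K_mono: "snd (tab a s) \<le> snd (tab a r)" if "s \<le> r" for a r s
    using lift_Suc_mono_le[of "\<lambda>r. snd (tab a r)"] tab0_Suc(2) tab1_Suc(2) tab2_Suc(2) that
    by (simp add: tab_def)
  \<comment> \<open>By monotonicity it suffices to look at row 0, with bounds 3, 4 and 2.\<close>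
  have K: "2 \<le> snd (tab a r)" for a r
    using K_mono[of 0 r a] by (auto simp: tab_def tab0_entries tab1_entries tab2_entries split: if_splits)
  have main: "rth_largest (cpx_le k) r (Er r k) \<and>
      of_nat (Er r k) = fst (tab a r) * of_nat (E k) \<and>
      Er r k > E (k - 1) \<and> cpx (Er r k) = k \<and> rth_largest (cpx_eq k) r (Er r k)"
    if "a \<in> {0, 1, 2}" "snd (tab a r) \<le> k" "[k = a] (mod 3)" for a r k
  proof (rule Er_from_enumeration)
    from that(1,3) have a: "k mod 3 = a" by (auto simp: cong_def)
    show "2 \<le> k" using K that(2) by (rule order_trans)
    show "fst (tab a (Suc s)) < fst (tab a s)" for s
      using tab0_Suc(1) tab1_Suc(1) tab2_Suc(1) by (simp add: tab_def)
    show "ratios k \<subseteq> range (\<lambda>r. fst (tab a r))"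
      using ratios0_subset_tab0 ratios1_subset_tab1 ratios2_subset_tab2 a
      by (simp add: ratios_def tab_def)
    show "threshold k < fst (tab a s)" for s
      using tab0_gt tab1_gt tab2_gt a by (simp add: threshold_def tab_def)
    show "attained k (fst (tab a s))" if "s \<le> r" for s
    proof -
      have "snd (tab a s) \<le> k" using K_mono[OF that] \<open>snd (tab a r) \<le> k\<close> by (rule order_trans)
      then show ?thesis
        using attained_tab0 attained_tab1 attained_tab2 a \<open>a \<in> {0, 1, 2}\<close> by (auto simp: tab_def)
    qed
  qed
  show ?thesis
  proof (intro exI conjI allI ballI impI)
    show "table0 (\<lambda>r. (fst (tab 0 r), snd (tab 0 r)))" using table0_tab0 by (simp add: tab_def)
    show "table2 (\<lambda>r. (fst (tab 2 r), snd (tab 2 r)))" using table2_tab2 by (simp add: tab_def)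
    show "table1 (\<lambda>r. (fst (tab 1 r), snd (tab 1 r)))" using table1_tab1 by (simp add: tab_def)
    show "1 < snd (tab a r)" for a r using K[of a r] by simp
  qed (use main in blast)+
qed

end
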